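(* Let Problem $B$ be the optimal control problem with data functions $E,F,f,e,h$ and bounds $e^L,e^U,h^L,h^U$ described in the context. Let $P_x\in\mathbb{R}^{N_x\times N_x}$ and $P_u\in\mathbb{R}^{N_u\times N_u}$ be invertible matrices, let $P_e\in\mathbb{R}^{N_e\times N_e}$ and $P_h\in\mathbb{R}^{N_h\times N_h}$ be positive definite diagonal matrices, let $p_J>0$, let $p_t,q_t,q_J$ be (real) scalars, and let $q_x\in\mathbb{R}^{N_x}$, $q_u\in\mathbb{R}^{N_u}$, $q_e\in\mathbb{R}^{N_e}$, $q_h\in\mathbb{R}^{N_h}$. Let Problem $\widetilde B$ be the corresponding scaled problem defined in the context. Let $\widetilde x^*(\cdot),\widetilde u^*(\cdot),\widetilde t_0^*,\widetilde t_f^*$ be an extremal solution to the scaled Problem $\widetilde B$, and let $\widetilde\lambda^*(\cdot),\widetilde\mu^*(\cdot),\widetilde\nu^*$ be a multiplier triple associated with this extremal solution. Let $P_\lambda,P_\mu,P_\nu$ be invertible matrices defined according to $$P_\lambda:=p_J\,[P_x^{-1}]^T,\qquad P_\mu:=\frac{p_J}{p_t}\,[P_h^{-1}]^T,\qquad P_\nu:=p_J\,[P_e^{-1}]^T .$$ Then an extremal solution to the unscaled Problem $B$ (with its associated multiplier triple) exists and is given by $$x^*(\cdot):=P_x\,\widetilde x^*(\cdot)+q_x,\qquad u^*(\cdot):=P_u\,\widetilde u^*(\cdot)+q_u,\qquad t:=p_t\,\widetilde t+q_t,$$ $$\lambda^*(\cdot):=P_\lambda\,\widetilde\lambda^*(\cdot),\qquad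 \mu^*(\cdot):=P_\mu\,\widetilde\mu^*(\cdot),\qquad \nu^*:=P_\nu\,\widetilde\nu^*,$$ where the unscaled functions are evaluated at $t=p_t\widetilde t+q_t$ when the scaled ones are evaluated at $\widetilde t$; in particular $t_0^*=p_t\widetilde t_0^*+q_t$ and $t_f^*=p_t\widetilde t_f^*+q_t$.
   Context: **Problem $B$.** Let $N_x,N_u$ be positive integers. The state is $x\in\mathbb{R}^{N_x}$ and the control is $u\in\mathbb{R}^{N_u}$. The data functions are: the endpoint cost $E(x_0,x_f,t_0,t_f)\in\mathbb{R}$; the running cost $F(x,u,t)\in\mathbb{R}$; the dynamics function $f(x,u,t)\in\mathbb{R}^{N_x}$; the endpoint constraint function $e(x_0,x_f,t_0,t_f)\in\mathbb{R}^{N_e}$; and the path constraint function $h(x,u,t)\in\mathbb{R}^{N_h}$. The derivatives of these functions appearing below are understood to exist. The lower and upper bounds $e^L,e^U\in\mathbb{R}^{N_e}$ and $h^L,h^U\in\mathbb{R}^{N_h}$ are given; vector inequalities are componentwise. Problem $B$ is: over $x(\cdot),u(\cdot),t_0,t_f$, minimize $$J[x(\cdot),u(\cdot),t_0,t_f]:=E(x(t_0),x(t_f),t_0,t_f)+\int_{t_0}^{t_f}F(x(t),u(t),t)\,dt$$ subject to $\dot x(t)=f(x(t),u(t),t)$, $e^L\le e(x(t_0),x(t_f),t_0,t_f)\le e^U$, and $h^L\le h(x(t),u(t),t)\le h^U$. **Extremal solution and multiplier triple.** Put $$H(\lambda,x,u,t):=F(x,u,t)+\lambda^Tf(x,u,t),\qquad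 \overline H(\mu,\lambda,x,u,t):=H(\lambda,x,u,t)+\mu^Th(x,u,t),$$ $$\mathcal H(\lambda,x,t):=\min_{u}H(\lambda,x,u,t),\qquad \overline E(\nu,x_0,x_f,t_0,t_f):=E(x_0,x_f,t_0,t_f)+\nu^Te(x_0,x_f,t_0,t_f),$$ and $\mathcal H[@t]:=\mathcal H(\lambda(t),x(t),t)$. Partial derivatives of scalar functions with respect to vectors are written as column vectors (gradients). An extremal solution to Problem $B$ is $(x(\cdot),u(\cdot),t_0,t_f)$ for which there exist functions $\lambda(\cdot)$ with values in $\mathbb{R}^{N_x}$, $\mu(\cdot)$ with values in $\mathbb{R}^{N_h}$, and a vector $\nu\in\mathbb{R}^{N_e}$ (the triple $(\lambda(\cdot),\mu(\cdot),\nu)$ is an associated multiplier triple) satisfying the following necessary conditions, called Problem $B^\lambda$, where $x_0=x(t_0)$, $x_f=x(t_f)$, and conditions involving $t$ hold for each $t$ in the time interval with endpoints $t_0,t_f$: 1. $\dot x(t)-\partial_\lambda\overline H(\mu(t),\lambda(t),x(t),u(t),t)=0$ (that is, $\dot x=f$); 2. $\dot\lambda(t)+\partial_x\overline H(\mu(t),\lambda(t),x(t),u(t),t)=0$; 3. $h^L\le h(x(t),u(t),t)\le h^U$; 4. $\partial_u\overline H(\mu(t),\lambda(t),x(t),u(t),t)=0$ and $\mu\,\dagger\,h$; 5. $e^L\le e(x_0,x_f,t_0,t_f)\le e^U$; 6. $\lambda(t_0)+\partial_{x_0}\overline E(\nu,x_0,x_f,t_0,t_f)=0$, $\lambda(t_f)-\partial_{x_f}\overline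 E(\nu,x_0,x_f,t_0,t_f)=0$, and $\nu\,\dagger\,e$; 7. $\mathcal H[@t_0]-\partial_{t_0}\overline E(\nu,x_0,x_f,t_0,t_f)=0$ and $\mathcal H[@t_f]+\partial_{t_f}\overline E(\nu,x_0,x_f,t_0,t_f)=0$. Here $\nu\,\dagger\,e$ denotes the complementarity conditions, for each component $i$: $\nu_i$ is unrestricted if $e_i^L=e_i^U$; otherwise $\nu_i\le0$ if $e_i(x_0,x_f,t_0,t_f)=e_i^L$, $\nu_i=0$ if $e_i^L<e_i(x_0,x_f,t_0,t_f)<e_i^U$, and $\nu_i\ge0$ if $e_i(x_0,x_f,t_0,t_f)=e_i^U$. The condition $\mu\,\dagger\,h$ is defined in the same way using $h^L,h^U$, for each $t$. **Scaled Problem $\widetilde B$.** It is obtained from Problem $B$ by the substitutions $x=P_x\widetilde x+q_x$, $u=P_u\widetilde u+q_u$, $t=p_t\widetilde t+q_t$, $J=p_J\widetilde J+q_J$, $e=P_e\widetilde e+q_e$, $h=P_h\widetilde h+q_h$. Explicitly, it is the problem of the same form as Problem $B$, in the variables $\widetilde x(\cdot),\widetilde u(\cdot),\widetilde t_0,\widetilde t_f$ and time $\widetilde t$, with data $$\widetilde E(\widetilde x_0,\widetilde x_f,\widetilde t_0,\widetilde t_f)=\tfrac1{p_J}E(P_x\widetilde x_0+q_x,\,P_x\widetilde x_f+q_x,\,p_t\widetilde t_0+q_t,\,p_t\widetilde t_f+q_t),$$ $$\widetilde F(\widetilde x,\widetilde u,\widetilde t)=\tfrac{p_t}{p_J}F(P_x\widetilde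 x+q_x,\,P_u\widetilde u+q_u,\,p_t\widetilde t+q_t),$$ $$\widetilde f(\widetilde x,\widetilde u,\widetilde t)=p_tP_x^{-1}f(P_x\widetilde x+q_x,\,P_u\widetilde u+q_u,\,p_t\widetilde t+q_t),$$ $$\widetilde e(\widetilde x_0,\widetilde x_f,\widetilde t_0,\widetilde t_f)=P_e^{-1}\big[e(P_x\widetilde x_0+q_x,\,P_x\widetilde x_f+q_x,\,p_t\widetilde t_0+q_t,\,p_t\widetilde t_f+q_t)-q_e\big],$$ $$\widetilde h(\widetilde x,\widetilde u,\widetilde t)=P_h^{-1}\big[h(P_x\widetilde x+q_x,\,P_u\widetilde u+q_u,\,p_t\widetilde t+q_t)-q_h\big],$$ bounds $\widetilde e^{L}=P_e^{-1}(e^L-q_e)$, $\widetilde e^{U}=P_e^{-1}(e^U-q_e)$, $\widetilde h^{L}=P_h^{-1}(h^L-q_h)$, $\widetilde h^{U}=P_h^{-1}(h^U-q_h)$, and cost $$\widetilde J=-\frac{q_J}{p_J}+\widetilde E+\int_{\widetilde t_0}^{\widetilde t_f}\widetilde F\,d\widetilde t .$$ The additive constant $-q_J/p_J$ plays no role in the necessary conditions. Extremal solutions and multiplier triples $(\widetilde\lambda(\cdot),\widetilde\mu(\cdot),\widetilde\nu)$ of Problem $\widetilde B$ are defined by conditions 1–7 with all data replaced by their tilde counterparts and derivatives taken with respect to the tilde variables.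
   Formalization: The scalar p_t is assumed positive: for p_t = 0 the matrix P_μ is undefined, and for p_t < 0 the claim fails, since P_μ reverses the sign of μ in the complementarity condition and the minimum of H over u becomes a maximum. *)

theory Defs
  imports "HOL-Analysis.Analysis"
begin

text \<open>
  Data of an optimal control problem with state in \<open>real ^ 'nx\<close>, control in \<open>real ^ 'nu\<close>,
  endpoint constraints in \<open>real ^ 'ne\<close> and path constraints in \<open>real ^ 'nh\<close>.
  \<open>cost_const\<close> is an additive constant in the cost functional: it is zero in the usual
  Bolza form, but rescaling the cost affinely produces a nonzero one.
\<close>

record ('nx, 'nu, 'ne, 'nh) ocp =
  end_cost :: "real ^ ('nx::finite) \<Rightarrow> real ^ 'nx \<Rightarrow> real \<Rightarrow> real \<Rightarrow> real"
  run_cost :: "real ^ 'nx \<Rightarrow> real ^ ('nu::finite) \<Rightarrow> real \<Rightarrow> real"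
  dynamics :: "real ^ 'nx \<Rightarrow> real ^ 'nu \<Rightarrow> real \<Rightarrow> real ^ 'nx"
  end_con :: "real ^ 'nx \<Rightarrow> real ^ 'nx \<Rightarrow> real \<Rightarrow> real \<Rightarrow> real ^ ('ne::finite)"
  path_con :: "real ^ 'nx \<Rightarrow> real ^ 'nu \<Rightarrow> real \<Rightarrow> real ^ ('nh::finite)"
  end_lower :: "real ^ 'ne"
  end_upper :: "real ^ 'ne"
  path_lower :: "real ^ 'nh"
  path_upper :: "real ^ 'nh"
  cost_const :: real

definition cost ::
  "('nx::finite, 'nu::finite, 'ne::finite, 'nh::finite) ocp \<Rightarrow>
   (real \<Rightarrow> real ^ 'nx) \<Rightarrow> (real \<Rightarrow> real ^ 'nu) \<Rightarrow> real \<Rightarrow> real \<Rightarrow> real" where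
  "cost B x u t0 tf =
     cost_const B + end_cost B (x t0) (x tf) t0 tf + (LBINT t=t0..tf. run_cost B (x t) (u t) t)"

definition hamiltonian ::
  "('nx::finite, 'nu::finite, 'ne::finite, 'nh::finite) ocp \<Rightarrow>
   real ^ 'nx \<Rightarrow> real ^ 'nx \<Rightarrow> real ^ 'nu \<Rightarrow> real \<Rightarrow> real" where
  "hamiltonian B l x u t = run_cost B x u t + l \<bullet> dynamics B x u t"

definition lagrangian_hamiltonian ::
  "('nx::finite, 'nu::finite, 'ne::finite, 'nh::finite) ocp \<Rightarrow>
   real ^ 'nh \<Rightarrow> real ^ 'nx \<Rightarrow> real ^ 'nx \<Rightarrow> real ^ 'nu \<Rightarrow> real \<Rightarrow> real" where
  "lagrangian_hamiltonian B m l x u t = hamiltonian B l x u t + m \<bullet> path_con B x u t"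

text \<open>
  The minimum over all controls. The infimum on the reals is only meaningful here when a
  minimiser exists, so every use is paired with \<open>has_minimizing_control\<close>.
\<close>

definition lower_hamiltonian ::
  "('nx::finite, 'nu::finite, 'ne::finite, 'nh::finite) ocp \<Rightarrow>
   real ^ 'nx \<Rightarrow> real ^ 'nx \<Rightarrow> real \<Rightarrow> real" where
  "lower_hamiltonian B l x t = (INF u. hamiltonian B l x u t)"

definition has_minimizing_control ::
  "('nx::finite, 'nu::finite, 'ne::finite, 'nh::finite) ocp \<Rightarrow>
   real ^ 'nx \<Rightarrow> real ^ 'nx \<Rightarrow> real \<Rightarrow> bool" where
  "has_minimizing_control B l x t \<longleftrightarrow>
     (\<exists>u. \<forall>v. hamiltonian B l x u t \<le> hamiltonian B l x v t)"

definition endpoint_lagrangian ::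
  "('nx::finite, 'nu::finite, 'ne::finite, 'nh::finite) ocp \<Rightarrow>
   real ^ 'ne \<Rightarrow> real ^ 'nx \<Rightarrow> real ^ 'nx \<Rightarrow> real \<Rightarrow> real \<Rightarrow> real" where
  "endpoint_lagrangian B n x0 xf t0 tf =
     end_cost B x0 xf t0 tf + n \<bullet> end_con B x0 xf t0 tf"

text \<open>\<open>complementary m g L U\<close> is the condition \<open>m \<dagger> g\<close> for the bounds \<open>L \<le> g \<le> U\<close>.\<close>

definition complementary ::
  "real ^ 'n \<Rightarrow> real ^ 'n \<Rightarrow> real ^ 'n \<Rightarrow> real ^ ('n::finite) \<Rightarrow> bool" where
  "complementary m g L U \<longleftrightarrow>
     (\<forall>i. L $ i \<noteq> U $ i \<longrightarrow>
        (g $ i = L $ i \<longrightarrow> m $ i \<le> 0) \<and>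
        (L $ i < g $ i \<and> g $ i < U $ i \<longrightarrow> m $ i = 0) \<and>
        (g $ i = U $ i \<longrightarrow> m $ i \<ge> 0))"

text \<open>
  The necessary conditions. Gradients and time derivatives enter relationally, so each
  condition also asserts that the derivatives it mentions exist; time derivatives are
  one-sided at the endpoints. The order on vectors is componentwise.
\<close>

definition multiplier_triple ::
  "('nx::finite, 'nu::finite, 'ne::finite, 'nh::finite) ocp \<Rightarrow>
   (real \<Rightarrow> real ^ 'nx) \<Rightarrow> (real \<Rightarrow> real ^ 'nu) \<Rightarrow> real \<Rightarrow> real \<Rightarrow>
   (real \<Rightarrow> real ^ 'nx) \<Rightarrow> (real \<Rightarrow> real ^ 'nh) \<Rightarrow> real ^ 'ne \<Rightarrow> bool" where
  "multiplier_triple B x u t0 tf l m n \<longleftrightarrow>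
     (\<forall>t \<in> closed_segment t0 tf.
        (\<exists>x' g. (x has_vector_derivative x') (at t within closed_segment t0 tf) \<and>
           (GDERIV (\<lambda>y. lagrangian_hamiltonian B (m t) y (x t) (u t) t) (l t) :> g) \<and>
           x' - g = 0) \<and>
        (\<exists>l' g. (l has_vector_derivative l') (at t within closed_segment t0 tf) \<and>
           (GDERIV (\<lambda>y. lagrangian_hamiltonian B (m t) (l t) y (u t) t) (x t) :> g) \<and>
           l' + g = 0) \<and>
        path_lower B \<le> path_con B (x t) (u t) t \<and>
        path_con B (x t) (u t) t \<le> path_upper B \<and>
        (GDERIV (\<lambda>v. lagrangian_hamiltonian B (m t) (l t) (x t) v t) (u t) :> 0) \<and>
        complementary (m t) (path_con B (x t) (u t) t) (path_lower B) (path_upper B)) \<and>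
     end_lower B \<le> end_con B (x t0) (x tf) t0 tf \<and>
     end_con B (x t0) (x tf) t0 tf \<le> end_upper B \<and>
     (\<exists>g. (GDERIV (\<lambda>y. endpoint_lagrangian B n y (x tf) t0 tf) (x t0) :> g) \<and> l t0 + g = 0) \<and>
     (\<exists>g. (GDERIV (\<lambda>y. endpoint_lagrangian B n (x t0) y t0 tf) (x tf) :> g) \<and> l tf - g = 0) \<and>
     complementary n (end_con B (x t0) (x tf) t0 tf) (end_lower B) (end_upper B) \<and>
     has_minimizing_control B (l t0) (x t0) t0 \<and>
     (\<exists>d. ((\<lambda>s. endpoint_lagrangian B n (x t0) (x tf) s tf) has_real_derivative d) (at t0) \<and>
        lower_hamiltonian B (l t0) (x t0) t0 - d = 0) \<and>
     has_minimizing_control B (l tf) (x tf) tf \<and>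
     (\<exists>d. ((\<lambda>s. endpoint_lagrangian B n (x t0) (x tf) t0 s) has_real_derivative d) (at tf) \<and>
        lower_hamiltonian B (l tf) (x tf) tf + d = 0)"

definition extremal_solution ::
  "('nx::finite, 'nu::finite, 'ne::finite, 'nh::finite) ocp \<Rightarrow>
   (real \<Rightarrow> real ^ 'nx) \<Rightarrow> (real \<Rightarrow> real ^ 'nu) \<Rightarrow> real \<Rightarrow> real \<Rightarrow> bool" where
  "extremal_solution B x u t0 tf \<longleftrightarrow> (\<exists>l m n. multiplier_triple B x u t0 tf l m n)"

definition pos_def_diagonal :: "real ^ 'n ^ ('n::finite) \<Rightarrow> bool" where
  "pos_def_diagonal P \<longleftrightarrow>
     (\<forall>i j. i \<noteq> j \<longrightarrow> P $ i $ j = 0) \<and> (\<forall>v. v \<noteq> 0 \<longrightarrow> 0 < v \<bullet> (P *v v))"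

text \<open>
  The problem obtained by substituting \<open>x = Px x~ + qx\<close>, \<open>u = Pu u~ + qu\<close>, \<open>t = pt t~ + qt\<close>,
  \<open>J = pJ J~ + qJ\<close>, \<open>e = Pe e~ + qe\<close>, \<open>h = Ph h~ + qh\<close>.
\<close>

definition scaled_problem ::
  "real ^ 'nx ^ 'nx \<Rightarrow> real ^ 'nx \<Rightarrow> real ^ 'nu ^ 'nu \<Rightarrow> real ^ 'nu \<Rightarrow>
   real \<Rightarrow> real \<Rightarrow> real \<Rightarrow> real \<Rightarrow>
   real ^ 'ne ^ 'ne \<Rightarrow> real ^ 'ne \<Rightarrow> real ^ 'nh ^ 'nh \<Rightarrow> real ^ 'nh \<Rightarrow>
   ('nx::finite, 'nu::finite, 'ne::finite, 'nh::finite) ocp \<Rightarrow> ('nx, 'nu, 'ne, 'nh) ocp" where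
  "scaled_problem Px qx Pu qu pt qt pJ qJ Pe qe Ph qh B =
     \<lparr> end_cost = (\<lambda>x0 xf t0 tf. (1 / pJ) *
         end_cost B (Px *v x0 + qx) (Px *v xf + qx) (pt * t0 + qt) (pt * tf + qt)),
       run_cost = (\<lambda>x u t. (pt / pJ) * run_cost B (Px *v x + qx) (Pu *v u + qu) (pt * t + qt)),
       dynamics = (\<lambda>x u t. pt *\<^sub>R
         (matrix_inv Px *v dynamics B (Px *v x + qx) (Pu *v u + qu) (pt * t + qt))),
       end_con = (\<lambda>x0 xf t0 tf. matrix_inv Pe *v
         (end_con B (Px *v x0 + qx) (Px *v xf + qx) (pt * t0 + qt) (pt * tf + qt) - qe)),
       path_con = (\<lambda>x u t. matrix_inv Ph *v
         (path_con B (Px *v x + qx) (Pu *v u + qu) (pt * t + qt) - qh)),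
       end_lower = matrix_inv Pe *v (end_lower B - qe),
       end_upper = matrix_inv Pe *v (end_upper B - qe),
       path_lower = matrix_inv Ph *v (path_lower B - qh),
       path_upper = matrix_inv Ph *v (path_upper B - qh),
       cost_const = (cost_const B - qJ) / pJ \<rparr>"

end

theory Submission
  imports Defs
begin

text \<open>
  The multiplier scalings are the ones for which the scalar functions of the two problems agree up
  to a positive factor and an additive constant. Along the substitution of all variables, including
  \<open>\<lambda> = P\<^sub>\<lambda> \<lambda>~\<close> and \<open>\<mu> = P\<^sub>\<mu> \<mu>~\<close>, moving the inverses of \<open>P\<^sub>x\<close> and \<open>P\<^sub>h\<close> across inner products
  turns the scaled Hamiltonian into \<open>p\<^sub>t / p\<^sub>J\<close> times the original one
  (\<open>hamiltonian_unscaled\<close>), the scaled Lagrangian of the Hamiltonian into \<open>p\<^sub>t / p\<^sub>J\<close> times the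
  original one up to the constant coming from \<open>q\<^sub>h\<close> (\<open>lagrangian_hamiltonian_unscaled\<close>), and the
  scaled endpoint Lagrangian into \<open>1 / p\<^sub>J\<close> times the original one up to the constant coming from
  \<open>q\<^sub>e\<close> (\<open>endpoint_lagrangian_unscaled\<close>).

  All stationarity, adjoint and transversality conditions then follow from the chain rule, which
  kills the constants. If \<open>g\<close> is a gradient in a scaled variable and \<open>P\<close> the matrix of the
  substitution, the gradient in the original variable is \<open>c P\<^sup>-\<^sup>T g\<close>, where \<open>c\<close> is the scalar factor
  (\<open>GDERIV_affine_substitution\<close>). For the state this is a multiple of \<open>P\<^sub>\<lambda> g\<close>, so that it can
  cancel against the costate \<open>P\<^sub>\<lambda> \<lambda>~\<close> or its derivative. For the costate, \<open>P\<^sub>\<lambda>\<^sup>-\<^sup>T\<close> is again a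
  multiple of \<open>P\<^sub>x\<close>, as the state equation needs.

  Two conditions are not of this kind. The minimised Hamiltonian scales because \<open>p\<^sub>t / p\<^sub>J\<close> is
  positive and the control substitution is onto (\<open>minimum_unscaled\<close>). Bounds and complementarity
  transfer index by index, because \<open>P\<^sub>e\<close> and \<open>P\<^sub>h\<close> are diagonal with positive entries, so neither
  the activity of a bound nor the sign of a multiplier changes (\<open>complementary_unscaled\<close>).
\<close>

section \<open>Matrices\<close>

lemma matrix_inv_mult:
  fixes P :: "real ^ 'n ^ 'n"
  assumes "invertible P"
  shows "P ** matrix_inv P = mat 1" and "matrix_inv P ** P = mat 1"
proof -
  have "P ** matrix_inv P = mat 1 \<and> matrix_inv P ** P = mat 1"
    using assms unfolding invertible_def matrix_inv_def by (rule someI_ex)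
  then show "P ** matrix_inv P = mat 1" and "matrix_inv P ** P = mat 1"
    by simp_all
qed

lemma matrix_inv_vector:
  fixes P :: "real ^ 'n ^ 'n"
  assumes "invertible P"
  shows "P *v (matrix_inv P *v y) = y" and "matrix_inv P *v (P *v y) = y"
  using matrix_inv_mult[OF assms] by (simp_all add: matrix_vector_mul_assoc)

lemma matrix_inv_eqI:
  fixes P Q :: "real ^ 'n ^ 'n"
  assumes "P ** Q = mat 1"
  shows "matrix_inv P = Q"
proof -
  have QP: "Q ** P = mat 1"
    using assms by (simp add: matrix_left_right_inverse)
  then have "invertible P"
    using assms invertible_def by blast
  have "matrix_inv P = (Q ** P) ** matrix_inv P"
    using QP by simp
  also have "\<dots> = Q ** (P ** matrix_inv P)"
    by (simp add: matrix_mul_assoc)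
  finally show ?thesis
    using matrix_inv_mult(1)[OF \<open>invertible P\<close>] by simp
qed

lemma inner_matrix_vector:
  fixes M :: "real ^ 'n ^ 'm"
  shows "a \<bullet> (M *v v) = (transpose M *v a) \<bullet> v"
  by (simp add: dot_lmul_matrix)

lemma invertible_scaled_transpose_inv:
  fixes P :: "real ^ 'n ^ 'n"
  assumes "invertible P" and "c \<noteq> 0"
  shows "invertible (c *\<^sub>R transpose (matrix_inv P))"
proof -
  have "invertible (matrix_inv P)"
    using matrix_inv_mult[OF assms(1)] invertible_def by blast
  then show ?thesis
    using assms(2) by (intro scalar_invertible transpose_invertible)
qed

text \<open>
  For the costate substitution \<open>c P\<^sup>-\<^sup>T\<close>, the inverse transpose that acts on gradients is a multiple
  of \<open>P\<close> itself. This is how the derivative of the Hamiltonian in the costate turns back into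
  the dynamics of the unscaled state.
\<close>

lemma transpose_inv_scaled_transpose_inv:
  fixes P :: "real ^ 'n ^ 'n"
  assumes "invertible P" and "c \<noteq> 0"
  shows "transpose (matrix_inv (c *\<^sub>R transpose (matrix_inv P))) = (1 / c) *\<^sub>R P"
proof -
  have "transpose (matrix_inv P) ** transpose P = mat 1"
    using matrix_inv_mult(1)[OF assms(1)]
    by (simp add: matrix_transpose_mul[symmetric] transpose_mat)
  then have "(c *\<^sub>R transpose (matrix_inv P)) ** ((1 / c) *\<^sub>R transpose P) = mat 1"
    using assms(2) by (simp add: scalar_matrix_assoc[symmetric] matrix_scalar_ac)
  then have "matrix_inv (c *\<^sub>R transpose (matrix_inv P)) = (1 / c) *\<^sub>R transpose P"
    by (rule matrix_inv_eqI)
  then show ?thesis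
    by (simp add: transpose_scalar)
qed

lemma diagonal_matrix_vector:
  fixes P :: "real ^ 'n ^ 'n"
  assumes "pos_def_diagonal P"
  shows "(P *v w) $ i = P $ i $ i * w $ i"
proof -
  have "(P *v w) $ i = (\<Sum>j\<in>UNIV. if j = i then P $ i $ i * w $ i else 0)"
    using assms unfolding matrix_vector_mult_def pos_def_diagonal_def vec_lambda_beta
    by (intro sum.cong) auto
  then show ?thesis
    by simp
qed

lemma pos_def_diagonal_entry_pos:
  fixes P :: "real ^ 'n ^ 'n"
  assumes "pos_def_diagonal P"
  shows "0 < P $ i $ i"
proof -
  have "axis i (1::real) \<noteq> 0"
    by (simp add: axis_eq_0_iff)
  then have "0 < axis i 1 \<bullet> (P *v axis i 1)"
    using assms by (auto simp: pos_def_diagonal_def)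
  then show ?thesis
    by (simp add: inner_axis' diagonal_matrix_vector[OF assms])
qed

lemma pos_def_diagonal_invertible:
  fixes P :: "real ^ 'n ^ 'n"
  assumes "pos_def_diagonal P"
  shows "invertible P"
proof -
  have "v = 0" if "P *v v = 0" for v
    using assms that by (metis inner_zero_right less_irrefl pos_def_diagonal_def)
  then show ?thesis
    using invertible_left_inverse matrix_left_invertible_ker by blast
qed

lemma pos_def_diagonal_inv_vector:
  fixes P :: "real ^ 'n ^ 'n"
  assumes "pos_def_diagonal P"
  shows "(matrix_inv P *v w) $ i = w $ i / P $ i $ i"
    and "(transpose (matrix_inv P) *v w) $ i = w $ i / P $ i $ i"
proof -
  note inv = pos_def_diagonal_invertible[OF assms]
  have entry: "P $ i $ i \<noteq> 0" for i
    using pos_def_diagonal_entry_pos[OF assms] by (metis less_irrefl)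
  have 1: "(matrix_inv P *v w) $ i = w $ i / P $ i $ i" for w i
    using diagonal_matrix_vector[OF assms, of "matrix_inv P *v w" i] matrix_inv_vector(1)[OF inv, of w]
      entry[of i] by (simp add: field_simps)
  then show "(matrix_inv P *v w) $ i = w $ i / P $ i $ i" .
  have "matrix_inv P *v axis i 1 = (1 / P $ i $ i) *\<^sub>R axis i 1"
    by (vector 1 axis_def)
  then show "(transpose (matrix_inv P) *v w) $ i = w $ i / P $ i $ i"
    using inner_matrix_vector[of w "matrix_inv P" "axis i 1"] by (simp add: inner_axis)
qed

section \<open>Derivatives under affine substitutions\<close>

text \<open>
  The chain rule for \<open>F y = c f (P\<^sup>-\<^sup>1 (y - q)) + k\<close>. Relating \<open>F\<close> to \<open>f\<close> along the substitution
  instead of through \<open>P\<^sup>-\<^sup>1\<close> is the form in which the Lagrangians of the two problems are related.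
\<close>

lemma GDERIV_affine_substitution:
  fixes P :: "real ^ 'n ^ 'n"
  assumes P: "invertible P"
    and F: "\<And>w. F (P *v w + q) = c * f w + k"
    and f: "GDERIV f z :> g"
  shows "GDERIV F (P *v z + q) :> c *\<^sub>R (transpose (matrix_inv P) *v g)"
proof -
  let ?w = "\<lambda>y. matrix_inv P *v (y - q)"
  have F': "F y = c * f (?w y) + k" for y
    using F[of "?w y"] by (simp add: matrix_inv_vector[OF P])
  have w: "(?w has_derivative (\<lambda>h. matrix_inv P *v h)) (at (P *v z + q))"
    by (intro bounded_linear.has_derivative[OF matrix_vector_mul_bounded_linear, THEN has_derivative_eq_rhs])
       (auto intro!: derivative_eq_intros)
  have f': "(f has_derivative (\<lambda>h. h \<bullet> g)) (at (?w (P *v z + q)))"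
    using f by (simp add: gderiv_def matrix_inv_vector[OF P])
  have "((\<lambda>y. c * f (?w y) + k) has_derivative (\<lambda>h. c * ((matrix_inv P *v h) \<bullet> g)))
      (at (P *v z + q))"
    using has_derivative_compose[OF w f'] by (auto intro!: derivative_eq_intros)
  moreover have "c * ((matrix_inv P *v h) \<bullet> g) = h \<bullet> (c *\<^sub>R (transpose (matrix_inv P) *v g))" for h
    using inner_matrix_vector[of g "matrix_inv P" h] by (simp add: inner_commute)
  ultimately show ?thesis
    unfolding gderiv_def F' by simp
qed

lemma DERIV_affine_substitution:
  fixes F f :: "real \<Rightarrow> real"
  assumes "p \<noteq> 0"
    and F: "\<And>s. F (p * s + q) = c * f s + k"
    and f: "(f has_real_derivative d) (at r)"
  shows "(F has_real_derivative c / p * d) (at (p * r + q))"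
proof -
  have F': "F = (\<lambda>t. c * f ((t - q) / p) + k)"
  proof
    show "F t = c * f ((t - q) / p) + k" for t
      using F[of "(t - q) / p"] \<open>p \<noteq> 0\<close> by simp
  qed
  have "((\<lambda>t. (t - q) / p) has_real_derivative 1 / p) (at (p * r + q))"
    using \<open>p \<noteq> 0\<close> by (auto intro!: derivative_eq_intros)
  moreover have "(f has_real_derivative d) (at ((p * r + q - q) / p))"
    using f \<open>p \<noteq> 0\<close> by simp
  ultimately have "((\<lambda>t. f ((t - q) / p)) has_real_derivative d * (1 / p)) (at (p * r + q))"
    by (rule DERIV_chain2[rotated])
  then show ?thesis
    unfolding F' by (auto intro!: derivative_eq_intros)
qed

lemma closed_segment_affine_image:
  fixes a b p q :: real
  shows "closed_segment (p * a + q) (p * b + q) = (\<lambda>s. p * s + q) ` closed_segment a b"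
proof -
  have "closed_segment (q + p * a) (q + p * b) = (+) q ` (*) p ` closed_segment a b"
    by (simp add: closed_segment_translation closed_segment_linear_image[OF linear_times])
  then show ?thesis
    by (simp add: image_image add.commute)
qed

text \<open>
  The derivative is taken within a set so that it covers the one-sided derivatives at the ends
  of the time interval.
\<close>

lemma has_vector_derivative_affine_substitution:
  fixes y :: "real \<Rightarrow> real ^ 'n" and A :: "real ^ 'n ^ 'n"
  assumes "p \<noteq> 0"
    and y: "(y has_vector_derivative y') (at s within S)"
  shows "((\<lambda>t. A *v y ((t - q) / p) + b) has_vector_derivative (1 / p) *\<^sub>R (A *v y'))
    (at (p * s + q) within (\<lambda>s. p * s + q) ` S)"
proof -
  let ?T = "(\<lambda>s. p * s + q) ` S"
  have "((\<lambda>t. (t - q) / p) has_vector_derivative 1 / p) (at (p * s + q) within ?T)"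
    using \<open>p \<noteq> 0\<close>
    by (auto simp: has_real_derivative_iff_has_vector_derivative[symmetric] intro!: derivative_eq_intros)
  moreover have "(y has_vector_derivative y')
      (at ((p * s + q - q) / p) within (\<lambda>t. (t - q) / p) ` ?T)"
    using y \<open>p \<noteq> 0\<close> by (simp add: image_image)
  ultimately have "(y \<circ> (\<lambda>t. (t - q) / p) has_vector_derivative (1 / p) *\<^sub>R y') (at (p * s + q) within ?T)"
    by (rule vector_diff_chain_within)
  then have "((\<lambda>t. A *v y ((t - q) / p)) has_vector_derivative A *v ((1 / p) *\<^sub>R y'))
      (at (p * s + q) within ?T)"
    unfolding o_def
    by (rule bounded_linear.has_vector_derivative[OF matrix_vector_mul_bounded_linear])
  then show ?thesis
    by (auto intro!: derivative_eq_intros simp: matrix_vector_mult_scaleR)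
qed

section \<open>Minimised Hamiltonian\<close>

lemma lower_hamiltonian_eq_minimum:
  assumes "\<And>v. hamiltonian B l x u t \<le> hamiltonian B l x v t"
  shows "lower_hamiltonian B l x t = hamiltonian B l x u t"
  unfolding lower_hamiltonian_def using assms
  by (intro cInf_eq_minimum) auto

section \<open>Complementarity under positive diagonal scaling\<close>

text \<open>
  A positive diagonal entry divides both sides of a componentwise comparison by the same positive
  number, so the scaled bounds are attained, and strictly satisfied, at exactly the same indices
  as the original ones. A general invertible matrix would mix components and destroy this.
\<close>

lemma scaled_component_compare:
  fixes P :: "real ^ 'n ^ 'n"
  assumes "pos_def_diagonal P"
  shows "(matrix_inv P *v (a - q)) $ i \<le> (matrix_inv P *v (b - q)) $ i \<longleftrightarrow> a $ i \<le> b $ i"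
    and "(matrix_inv P *v (a - q)) $ i < (matrix_inv P *v (b - q)) $ i \<longleftrightarrow> a $ i < b $ i"
    and "(matrix_inv P *v (a - q)) $ i = (matrix_inv P *v (b - q)) $ i \<longleftrightarrow> a $ i = b $ i"
  using pos_def_diagonal_entry_pos[OF assms, of i]
  by (simp_all add: pos_def_diagonal_inv_vector[OF assms] divide_le_cancel divide_less_cancel)

lemma scaled_bound_iff:
  fixes P :: "real ^ 'n ^ 'n"
  assumes "pos_def_diagonal P"
  shows "matrix_inv P *v (a - q) \<le> matrix_inv P *v (b - q) \<longleftrightarrow> a \<le> b"
  by (simp add: less_eq_vec_def scaled_component_compare[OF assms])

text \<open>
  With \<open>P\<close> diagonal, the new multiplier is the old one with each component multiplied by the
  positive number \<open>c / P\<^sub>i\<^sub>i\<close>, which keeps every sign condition.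
\<close>

lemma complementary_unscaled:
  fixes P :: "real ^ 'n ^ 'n"
  assumes P: "pos_def_diagonal P" and c: "c > 0"
    and m: "complementary m (matrix_inv P *v (g - q)) (matrix_inv P *v (L - q)) (matrix_inv P *v (R - q))"
  shows "complementary ((c *\<^sub>R transpose (matrix_inv P)) *v m) g L R"
proof -
  let ?m = "(c *\<^sub>R transpose (matrix_inv P)) *v m"
  have m_i: "?m $ i = c / P $ i $ i * m $ i" for i
    by (simp add: scaleR_matrix_vector_assoc[symmetric] pos_def_diagonal_inv_vector[OF P]
        del: transpose_matrix_vector)
  have pos: "c / P $ i $ i > 0" for i
    using c pos_def_diagonal_entry_pos[OF P] by simp
  have "?m $ i \<le> 0 \<longleftrightarrow> m $ i \<le> 0" and "?m $ i = 0 \<longleftrightarrow> m $ i = 0" and "0 \<le> ?m $ i \<longleftrightarrow> 0 \<le> m $ i" for i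
    unfolding m_i using mult_le_cancel_left_pos[OF pos, of i "m $ i" 0]
      mult_le_cancel_left_pos[OF pos, of i 0 "m $ i"] pos[of i] by auto
  then show ?thesis
    using m unfolding complementary_def scaled_component_compare[OF P] by simp
qed

section \<open>The scaled problem\<close>

locale scaling =
  fixes B :: "('nx::finite, 'nu::finite, 'ne::finite, 'nh::finite) ocp"
    and Px :: "real ^ 'nx ^ 'nx" and qx :: "real ^ 'nx"
    and Pu :: "real ^ 'nu ^ 'nu" and qu :: "real ^ 'nu"
    and pt qt pJ qJ :: real
    and Pe :: "real ^ 'ne ^ 'ne" and qe :: "real ^ 'ne"
    and Ph :: "real ^ 'nh ^ 'nh" and qh :: "real ^ 'nh"
  assumes Px: "invertible Px" and Pu: "invertible Pu"
    and Pe: "pos_def_diagonal Pe" and Ph: "pos_def_diagonal Ph"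
    and pJ: "pJ > 0" and pt: "pt > 0"
begin

abbreviation "Bs \<equiv> scaled_problem Px qx Pu qu pt qt pJ qJ Pe qe Ph qh B"
abbreviation "Pl \<equiv> pJ *\<^sub>R transpose (matrix_inv Px)"
abbreviation "Pm \<equiv> (pJ / pt) *\<^sub>R transpose (matrix_inv Ph)"
abbreviation "Pn \<equiv> pJ *\<^sub>R transpose (matrix_inv Pe)"

abbreviation "X x \<equiv> Px *v x + qx"
abbreviation "U u \<equiv> Pu *v u + qu"
abbreviation "T s \<equiv> pt * s + qt"

text \<open>
  The factor \<open>p\<^sub>t\<close> in the scaled dynamics and running cost comes from the change of time, the factor
  \<open>1 / p\<^sub>J\<close> from the cost; \<open>P\<^sub>\<lambda> = p\<^sub>J P\<^sub>x\<^sup>-\<^sup>T\<close> is what makes both terms carry the same quotient.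
\<close>

lemma hamiltonian_unscaled:
  "hamiltonian B (Pl *v l) (X x) (U u) (T s) = pJ / pt * hamiltonian Bs l x u s"
  using pJ pt inner_matrix_vector[of l "matrix_inv Px"]
  by (simp add: hamiltonian_def scaled_problem_def scaleR_matrix_vector_assoc[symmetric] field_simps)

text \<open>
  The path constraint carries no factor from the time or the cost, so the factor of \<open>P\<^sub>\<mu>\<close> has to
  supply it: this is why \<open>P\<^sub>\<mu>\<close> contains \<open>p\<^sub>J / p\<^sub>t\<close>. The shift \<open>q\<^sub>h\<close> contributes a term that is
  constant in the state, the costate and the control.
\<close>

lemma lagrangian_hamiltonian_unscaled:
  "lagrangian_hamiltonian B (Pm *v m) (Pl *v l) (X x) (U u) (T s) =
     pJ / pt * lagrangian_hamiltonian Bs m l x u s + (Pm *v m) \<bullet> qh"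
proof -
  have "path_con Bs x u s = matrix_inv Ph *v (path_con B (X x) (U u) (T s) - qh)"
    by (simp add: scaled_problem_def)
  then have "pJ / pt * (m \<bullet> path_con Bs x u s) + (Pm *v m) \<bullet> qh
      = (Pm *v m) \<bullet> path_con B (X x) (U u) (T s)"
    using inner_matrix_vector[of m "matrix_inv Ph"]
    by (simp add: scaleR_matrix_vector_assoc[symmetric] inner_diff_right right_diff_distrib)
  then show ?thesis
    by (simp add: lagrangian_hamiltonian_def hamiltonian_unscaled distrib_left)
qed

lemma endpoint_lagrangian_unscaled:
  "endpoint_lagrangian B (Pn *v n) (X x0) (X xf) (T s0) (T sf) =
     pJ * endpoint_lagrangian Bs n x0 xf s0 sf + (Pn *v n) \<bullet> qe"
proof -
  have "end_con Bs x0 xf s0 sf = matrix_inv Pe *v (end_con B (X x0) (X xf) (T s0) (T sf) - qe)"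
    by (simp add: scaled_problem_def)
  then have "pJ * (n \<bullet> end_con Bs x0 xf s0 sf) + (Pn *v n) \<bullet> qe
      = (Pn *v n) \<bullet> end_con B (X x0) (X xf) (T s0) (T sf)"
    using inner_matrix_vector[of n "matrix_inv Pe"]
    by (simp add: scaleR_matrix_vector_assoc[symmetric] inner_diff_right right_diff_distrib)
  moreover have "end_cost B (X x0) (X xf) (T s0) (T sf) = pJ * end_cost Bs x0 xf s0 sf"
    using pJ by (simp add: scaled_problem_def)
  ultimately show ?thesis
    by (simp add: endpoint_lagrangian_def distrib_left)
qed

text \<open>
  The infimum of a set of reals is uninformative when the set is unbounded below, so it is computed
  as the value at a minimiser. Since \<open>P\<^sub>u\<close> is invertible, every original control comes from a scaled
  one, and so the image of a scaled minimiser beats all of them.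
\<close>

lemma minimum_unscaled:
  assumes "has_minimizing_control Bs l x s"
  shows "has_minimizing_control B (Pl *v l) (X x) (T s)"
    and "lower_hamiltonian B (Pl *v l) (X x) (T s) = pJ / pt * lower_hamiltonian Bs l x s"
proof -
  obtain u where u: "\<And>v. hamiltonian Bs l x u s \<le> hamiltonian Bs l x v s"
    using assms unfolding has_minimizing_control_def by blast
  have U: "hamiltonian B (Pl *v l) (X x) (U u) (T s) \<le> hamiltonian B (Pl *v l) (X x) v (T s)" for v
  proof -
    have "v = U (matrix_inv Pu *v (v - qu))"
      by (simp add: matrix_inv_vector[OF Pu])
    moreover have "pJ / pt * hamiltonian Bs l x u s
        \<le> pJ / pt * hamiltonian Bs l x (matrix_inv Pu *v (v - qu)) s"
      using u pJ pt by (intro mult_left_mono) auto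
    ultimately show ?thesis
      by (metis hamiltonian_unscaled)
  qed
  then show "has_minimizing_control B (Pl *v l) (X x) (T s)"
    unfolding has_minimizing_control_def by blast
  show "lower_hamiltonian B (Pl *v l) (X x) (T s) = pJ / pt * lower_hamiltonian Bs l x s"
    using lower_hamiltonian_eq_minimum[OF U] lower_hamiltonian_eq_minimum[OF u]
    by (simp add: hamiltonian_unscaled)
qed

text \<open>
  Each equation among the original conditions is the scaled one multiplied by an invertible factor:
  \<open>P\<^sub>x / p\<^sub>t\<close> for the state equation, \<open>P\<^sub>\<lambda> / p\<^sub>t\<close> for the adjoint equation, \<open>p\<^sub>J / p\<^sub>t P\<^sub>u\<^sup>-\<^sup>T\<close> for
  stationarity in the control, \<open>P\<^sub>\<lambda>\<close> for transversality in the state, and \<open>p\<^sub>J / p\<^sub>t\<close> for the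
  minimised Hamiltonian.
\<close>

lemma multiplier_triple_unscaled:
  assumes M: "multiplier_triple Bs xs us t0s tfs ls ms ns"
  defines "r \<equiv> \<lambda>t. (t - qt) / pt"
  shows "multiplier_triple B (\<lambda>t. X (xs (r t))) (\<lambda>t. U (us (r t))) (T t0s) (T tfs)
    (\<lambda>t. Pl *v ls (r t)) (\<lambda>t. Pm *v ms (r t)) (Pn *v ns)"
proof -
  have r: "r (T s) = s" for s
    using pt by (simp add: r_def)
  have nz: "pt \<noteq> 0" "pJ \<noteq> 0" and c: "pJ / pt > 0"
    using pt pJ by simp_all
  have Pl: "invertible Pl"
    using Px nz by (intro invertible_scaled_transpose_inv)
  let ?S = "closed_segment t0s tfs" and ?T = "closed_segment (T t0s) (T tfs)"
  have seg: "?T = T ` ?S"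
    by (rule closed_segment_affine_image)
  show ?thesis
    unfolding multiplier_triple_def r
  proof (intro conjI ballI)
    fix t assume "t \<in> ?T"
    then obtain s where s: "s \<in> ?S" and t: "t = T s"
      unfolding seg by blast
    note at_s = M[unfolded multiplier_triple_def, THEN conjunct1, rule_format, OF s]
    let ?L = "lagrangian_hamiltonian B"
    obtain x' g where "(xs has_vector_derivative x') (at s within ?S)"
      and g: "GDERIV (\<lambda>y. lagrangian_hamiltonian Bs (ms s) y (xs s) (us s) s) (ls s) :> g"
      and "x' - g = 0"
      using at_s by blast
    then have "((\<lambda>t. X (xs (r t))) has_vector_derivative (1 / pt) *\<^sub>R (Px *v g)) (at t within ?T)"
      unfolding t seg r_def using has_vector_derivative_affine_substitution[OF nz(1)] by auto
    moreover
    \<comment> \<open>The costate is substituted linearly, hence with shift \<open>0\<close>.\<close>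
    have "GDERIV (\<lambda>y. ?L (Pm *v ms s) y (X (xs s)) (U (us s)) t) (Pl *v ls s + 0)
        :> (pJ / pt) *\<^sub>R (transpose (matrix_inv Pl) *v g)"
      unfolding t
      by (rule GDERIV_affine_substitution[OF Pl _ g])
         (simp only: add_0_right lagrangian_hamiltonian_unscaled)
    then have "GDERIV (\<lambda>y. ?L (Pm *v ms s) y (X (xs s)) (U (us s)) t) (Pl *v ls s)
        :> (1 / pt) *\<^sub>R (Px *v g)"
      using nz unfolding transpose_inv_scaled_transpose_inv[OF Px nz(2)]
      by (simp add: scaleR_matrix_vector_assoc[symmetric])
    ultimately show "\<exists>x' g. ((\<lambda>t. X (xs (r t))) has_vector_derivative x') (at t within ?T) \<and>
        (GDERIV (\<lambda>y. ?L (Pm *v ms (r t)) y (X (xs (r t))) (U (us (r t))) t) (Pl *v ls (r t)) :> g) \<and>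
        x' - g = 0"
      unfolding t r by fastforce
  next
    fix t assume "t \<in> ?T"
    then obtain s where s: "s \<in> ?S" and t: "t = T s"
      unfolding seg by blast
    note at_s = M[unfolded multiplier_triple_def, THEN conjunct1, rule_format, OF s]
    let ?L = "lagrangian_hamiltonian B"
    obtain l' g where l': "(ls has_vector_derivative l') (at s within ?S)"
      and g: "GDERIV (\<lambda>y. lagrangian_hamiltonian Bs (ms s) (ls s) y (us s) s) (xs s) :> g"
      and lg: "l' + g = 0"
      using at_s by blast
    have "((\<lambda>t. Pl *v ls (r t)) has_vector_derivative (1 / pt) *\<^sub>R (Pl *v l')) (at t within ?T)"
      unfolding t seg r_def
      using has_vector_derivative_affine_substitution[OF nz(1) l', where b = 0] by simp
    moreover have "GDERIV (\<lambda>y. ?L (Pm *v ms s) (Pl *v ls s) y (U (us s)) t) (X (xs s))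
        :> (pJ / pt) *\<^sub>R (transpose (matrix_inv Px) *v g)"
      unfolding t by (rule GDERIV_affine_substitution[OF Px lagrangian_hamiltonian_unscaled g])
    moreover have "(1 / pt) *\<^sub>R (Pl *v l') + (pJ / pt) *\<^sub>R (transpose (matrix_inv Px) *v g)
        = (1 / pt) *\<^sub>R (Pl *v (l' + g))"
      by (simp add: scaleR_matrix_vector_assoc[symmetric] matrix_vector_right_distrib scaleR_add_right
          del: transpose_matrix_vector)
    ultimately show "\<exists>l' g. ((\<lambda>t. Pl *v ls (r t)) has_vector_derivative l') (at t within ?T) \<and>
        (GDERIV (\<lambda>y. ?L (Pm *v ms (r t)) (Pl *v ls (r t)) y (U (us (r t))) t) (X (xs (r t))) :> g) \<and>
        l' + g = 0"
      unfolding t r using lg by (metis matrix_vector_mult_0_right scaleR_zero_right)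
  next
    fix t assume "t \<in> ?T"
    then obtain s where s: "s \<in> ?S" and t: "t = T s"
      unfolding seg by blast
    note at_s = M[unfolded multiplier_triple_def, THEN conjunct1, rule_format, OF s]
    have "path_lower Bs \<le> path_con Bs (xs s) (us s) s" "path_con Bs (xs s) (us s) s \<le> path_upper Bs"
      using at_s by blast+
    then show "path_lower B \<le> path_con B (X (xs (r t))) (U (us (r t))) t"
      and "path_con B (X (xs (r t))) (U (us (r t))) t \<le> path_upper B"
      unfolding t r by (simp_all add: scaled_problem_def scaled_bound_iff[OF Ph])
    have "GDERIV (\<lambda>v. lagrangian_hamiltonian Bs (ms s) (ls s) (xs s) v s) (us s) :> 0"
      using at_s by blast
    from GDERIV_affine_substitution[OF Pu lagrangian_hamiltonian_unscaled this]
    show "GDERIV (\<lambda>v. lagrangian_hamiltonian B (Pm *v ms (r t)) (Pl *v ls (r t)) (X (xs (r t))) v t)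
        (U (us (r t))) :> 0"
      unfolding t r by (simp del: transpose_matrix_vector)
    have "complementary (ms s) (path_con Bs (xs s) (us s) s) (path_lower Bs) (path_upper Bs)"
      using at_s by blast
    then show "complementary (Pm *v ms (r t)) (path_con B (X (xs (r t))) (U (us (r t))) t)
        (path_lower B) (path_upper B)"
      unfolding t r by (intro complementary_unscaled[OF Ph c]) (simp add: scaled_problem_def)
  next
    note ends = M[unfolded multiplier_triple_def, THEN conjunct2]
    have "end_lower Bs \<le> end_con Bs (xs t0s) (xs tfs) t0s tfs"
      and "end_con Bs (xs t0s) (xs tfs) t0s tfs \<le> end_upper Bs"
      using ends by blast+
    then show "end_lower B \<le> end_con B (X (xs t0s)) (X (xs tfs)) (T t0s) (T tfs)"
      and "end_con B (X (xs t0s)) (X (xs tfs)) (T t0s) (T tfs) \<le> end_upper B"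
      by (simp_all add: scaled_problem_def scaled_bound_iff[OF Pe])
    have "complementary ns (end_con Bs (xs t0s) (xs tfs) t0s tfs) (end_lower Bs) (end_upper Bs)"
      using ends by blast
    then show "complementary (Pn *v ns) (end_con B (X (xs t0s)) (X (xs tfs)) (T t0s) (T tfs))
        (end_lower B) (end_upper B)"
      by (intro complementary_unscaled[OF Pe pJ]) (simp add: scaled_problem_def)
    let ?E = "endpoint_lagrangian B (Pn *v ns)"
    obtain g where g: "GDERIV (\<lambda>y. endpoint_lagrangian Bs ns y (xs tfs) t0s tfs) (xs t0s) :> g"
      and l: "ls t0s + g = 0"
      using ends by blast
    have "Pl *v ls t0s + pJ *\<^sub>R (transpose (matrix_inv Px) *v g) = Pl *v (ls t0s + g)"
      by (simp add: scaleR_matrix_vector_assoc[symmetric] matrix_vector_right_distrib scaleR_add_right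
          del: transpose_matrix_vector)
    with l GDERIV_affine_substitution[OF Px endpoint_lagrangian_unscaled g]
    show "\<exists>g. (GDERIV (\<lambda>y. ?E y (X (xs tfs)) (T t0s) (T tfs)) (X (xs t0s)) :> g) \<and> Pl *v ls t0s + g = 0"
      by (metis matrix_vector_mult_0_right)
    obtain g where g: "GDERIV (\<lambda>y. endpoint_lagrangian Bs ns (xs t0s) y t0s tfs) (xs tfs) :> g"
      and l: "ls tfs - g = 0"
      using ends by blast
    have "Pl *v ls tfs - pJ *\<^sub>R (transpose (matrix_inv Px) *v g) = Pl *v (ls tfs - g)"
      by (simp add: scaleR_matrix_vector_assoc[symmetric] matrix_vector_mult_diff_distrib
          scaleR_diff_right del: transpose_matrix_vector)
    with l GDERIV_affine_substitution[OF Px endpoint_lagrangian_unscaled g]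
    show "\<exists>g. (GDERIV (\<lambda>y. ?E (X (xs t0s)) y (T t0s) (T tfs)) (X (xs tfs)) :> g) \<and> Pl *v ls tfs - g = 0"
      by (metis matrix_vector_mult_0_right)
    have min: "has_minimizing_control Bs (ls t0s) (xs t0s) t0s" "has_minimizing_control Bs (ls tfs) (xs tfs) tfs"
      using ends by blast+
    then show "has_minimizing_control B (Pl *v ls t0s) (X (xs t0s)) (T t0s)"
      and "has_minimizing_control B (Pl *v ls tfs) (X (xs tfs)) (T tfs)"
      using minimum_unscaled(1) by blast+
    obtain d where d: "((\<lambda>s. endpoint_lagrangian Bs ns (xs t0s) (xs tfs) s tfs) has_real_derivative d) (at t0s)"
      and low: "lower_hamiltonian Bs (ls t0s) (xs t0s) t0s - d = 0"
      using ends by blast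
    have "lower_hamiltonian B (Pl *v ls t0s) (X (xs t0s)) (T t0s) - pJ / pt * d = 0"
      using low unfolding minimum_unscaled(2)[OF min(1)] by simp
    with DERIV_affine_substitution[OF nz(1) endpoint_lagrangian_unscaled d]
    show "\<exists>d. ((\<lambda>s. ?E (X (xs t0s)) (X (xs tfs)) s (T tfs)) has_real_derivative d) (at (T t0s)) \<and>
        lower_hamiltonian B (Pl *v ls t0s) (X (xs t0s)) (T t0s) - d = 0"
      by blast
    obtain d where d: "((\<lambda>s. endpoint_lagrangian Bs ns (xs t0s) (xs tfs) t0s s) has_real_derivative d) (at tfs)"
      and low: "lower_hamiltonian Bs (ls tfs) (xs tfs) tfs + d = 0"
      using ends by blast
    have "lower_hamiltonian B (Pl *v ls tfs) (X (xs tfs)) (T tfs) + pJ / pt * d = 0"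
      using low unfolding minimum_unscaled(2)[OF min(2)] by (simp add: eq_neg_iff_add_eq_0[symmetric])
    with DERIV_affine_substitution[OF nz(1) endpoint_lagrangian_unscaled d]
    show "\<exists>d. ((\<lambda>s. ?E (X (xs t0s)) (X (xs tfs)) (T t0s) s) has_real_derivative d) (at (T tfs)) \<and>
        lower_hamiltonian B (Pl *v ls tfs) (X (xs tfs)) (T tfs) + d = 0"
      by blast
  qed
qed

end

theorem propositionA:
  fixes B :: "('nx::finite, 'nu::finite, 'ne::finite, 'nh::finite) ocp"
    and Px :: "real ^ 'nx ^ 'nx" and Pu :: "real ^ 'nu ^ 'nu"
    and Pe :: "real ^ 'ne ^ 'ne" and Ph :: "real ^ 'nh ^ 'nh"
    and qx :: "real ^ 'nx" and qu :: "real ^ 'nu" and qe :: "real ^ 'ne" and qh :: "real ^ 'nh"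
    and pt qt pJ qJ :: real
    and xs :: "real \<Rightarrow> real ^ 'nx" and us :: "real \<Rightarrow> real ^ 'nu" and t0s tfs :: real
    and ls :: "real \<Rightarrow> real ^ 'nx" and ms :: "real \<Rightarrow> real ^ 'nh" and ns :: "real ^ 'ne"
    and Pl :: "real ^ 'nx ^ 'nx" and Pm :: "real ^ 'nh ^ 'nh" and Pn :: "real ^ 'ne ^ 'ne"
  assumes "invertible Px" and "invertible Pu"
    and "pos_def_diagonal Pe" and "pos_def_diagonal Ph"
    and "pJ > 0" and "pt > 0"
    and "extremal_solution (scaled_problem Px qx Pu qu pt qt pJ qJ Pe qe Ph qh B) xs us t0s tfs"
    and "multiplier_triple (scaled_problem Px qx Pu qu pt qt pJ qJ Pe qe Ph qh B)
           xs us t0s tfs ls ms ns"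
    and "Pl = pJ *\<^sub>R transpose (matrix_inv Px)"
    and "Pm = (pJ / pt) *\<^sub>R transpose (matrix_inv Ph)"
    and "Pn = pJ *\<^sub>R transpose (matrix_inv Pe)"
  shows "invertible Pl \<and> invertible Pm \<and> invertible Pn \<and>
    (\<exists>x u t0 tf l m n.
       extremal_solution B x u t0 tf \<and>
       multiplier_triple B x u t0 tf l m n \<and>
       (\<forall>s. x (pt * s + qt) = Px *v xs s + qx) \<and>
       (\<forall>s. u (pt * s + qt) = Pu *v us s + qu) \<and>
       t0 = pt * t0s + qt \<and> tf = pt * tfs + qt \<and>
       (\<forall>s. l (pt * s + qt) = Pl *v ls s) \<and>
       (\<forall>s. m (pt * s + qt) = Pm *v ms s) \<and>
       n = Pn *v ns)"
proof -
  interpret scaling B Px qx Pu qu pt qt pJ qJ Pe qe Ph qh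
    using assms by unfold_locales
  define r where "r = (\<lambda>t. (t - qt) / pt)"
  have r: "r (pt * s + qt) = s" for s
    using \<open>pt > 0\<close> by (simp add: r_def)
  have "invertible Pl" "invertible Pm" "invertible Pn"
    unfolding assms(9-11) using Px pos_def_diagonal_invertible[OF Ph]
      pos_def_diagonal_invertible[OF Pe] \<open>pJ > 0\<close> \<open>pt > 0\<close>
    by (simp_all add: invertible_scaled_transpose_inv)
  moreover have "multiplier_triple B (\<lambda>t. Px *v xs (r t) + qx) (\<lambda>t. Pu *v us (r t) + qu)
      (pt * t0s + qt) (pt * tfs + qt) (\<lambda>t. Pl *v ls (r t)) (\<lambda>t. Pm *v ms (r t)) (Pn *v ns)"
    using multiplier_triple_unscaled[OF assms(8)] unfolding assms(9-11) r_def .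
  ultimately show ?thesis
    unfolding extremal_solution_def
    by (intro conjI exI[of _ "\<lambda>t. Px *v xs (r t) + qx"] exI[of _ "\<lambda>t. Pu *v us (r t) + qu"]
        exI[of _ "\<lambda>t. Pl *v ls (r t)"] exI[of _ "\<lambda>t. Pm *v ms (r t)"] exI[of _ "Pn *v ns"]
        exI[of _ "pt * t0s + qt"] exI[of _ "pt * tfs + qt"]) (auto simp: r)
qed

end
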